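(* Let $m\ge0$ and let $(\Phi^{m+1},\Gamma^{m+1})\in\mathbb F^{m+1}\times\mathbb K^h$ be a solution of the fully discrete surfactant system $$\frac1\tau(\Phi^{m+1},\zeta^h)_{\Omega_1^{m+1}}+\frac1{Pe_\Phi}(\nabla\Phi^{m+1},\nabla\zeta^h)_{\Omega_1^{m+1}}-\bigl(\Phi^{m+1}(\pi_2^{m+1}\mathbf u^{m+1}-\mathbf w^{m+1}),\nabla\zeta^h\bigr)_{\Omega_1^{m+1}}=\frac1\tau\bigl(\Phi^m,\zeta^h\circ\mathcal A_{h,t_m}^{-1}\bigr)_{\Omega_1^m}-Da\,\bigl(S^{m+\frac12},\zeta^h\bigr)^h_{\Sigma^{m+1}}\quad\forall\zeta^h\in\mathbb F^{m+1},$$ $$\frac1\tau(\Gamma^{m+1},\phi^h)^h_{\Sigma^{m+1}}+\frac1{Pe_\Gamma}(\nabla_s\Gamma^{m+1},\nabla_s\phi^h)_{\Sigma^{m+1}}-\bigl(\Gamma^{m+1}(\pi_2^{m+1}\mathbf u^{m+1}-\mathbf w_\Sigma^{m+1}),\nabla_s\phi^h\bigr)^h_{\Sigma^{m+1}}=\frac1\tau(\Gamma^m,\phi^h)^h_{\Sigma^m}+\bigl(S^{m+\frac12},\phi^h\bigr)^h_{\Sigma^{m+1}}\quad\forall\phi^h\in\mathbb K^h,$$ where $\Phi^m\in\mathbb F^m$ and $\Gamma^m\in\mathbb K^h$ are given and $$S^{m+\frac12}=Bi\,\lambda\,\Phi^{m+1}-Bi\,\bigl(\lambda\,\Phi^m\circ\mathcal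 A_{h,t_m}+1\bigr)\Gamma^{m+1}\quad\text{on }\Sigma^{m+1}.$$ Then $$(\Phi^{m+1},1)_{\Omega_1^{m+1}}+Da\,(\Gamma^{m+1},1)^h_{\Sigma^{m+1}}=(\Phi^m,1)_{\Omega_1^m}+Da\,(\Gamma^m,1)^h_{\Sigma^m}.$$
   Context: Constants: time step $\tau>0$, $t_m=m\tau$, and positive parameters $Pe_\Phi,Pe_\Gamma,Da,Bi,\lambda$. Interface mesh. $\mathbb I=[0,1]=\bigcup_{j=1}^{J_\Sigma}\mathbb I_j$, $\mathbb I_j=[\alpha_{j-1},\alpha_j]$, $\alpha_j=j/J_\Sigma$. $\mathbb K^h$ is the space of continuous functions on $\mathbb I$ that are affine on each $\mathbb I_j$. For each time level $m$, the discrete interface is the polygonal curve $\Sigma^m=\mathbf X^m(\mathbb I)\subset\mathbb R^2$, where $\mathbf X^m:\mathbb I\to\mathbb R^2$ is continuous and affine on each $\mathbb I_j$; put $\mathbf h^m_j=\mathbf X^m(\alpha_j)-\mathbf X^m(\alpha_{j-1})\neq\mathbf 0$. Functions on $\Sigma^m$ are identified with functions on $\mathbb I$ via $\mathbf X^m$. For functions $u,v$ (scalar- or vector-valued, possibly discontinuous at the nodes, with one-sided limits $u(\alpha_j^\pm)$) two quadratures are used: $$(u,v)^h_{\Sigma^m}=\tfrac12\sum_{j=1}^{J_\Sigma}|\mathbf h_j^m|\bigl[(u\cdot v)(\alpha_{j-1}^+)+(u\cdot v)(\alpha_j^-)\bigr],$$ $$(u,v)_{\Sigma^m}=\tfrac16\sum_{j=1}^{J_\Sigma}|\mathbf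 h_j^m|\bigl[(u\cdot v)(\alpha_{j-1}^+)+4(u\cdot v)(\tfrac{\alpha_{j-1}+\alpha_j}{2})+(u\cdot v)(\alpha_j^-)\bigr].$$ $\nabla_s$ on $\Sigma^m$ is the (piecewise constant) tangential gradient: $\nabla_s\phi=(\partial_\alpha\phi/|\partial_\alpha\mathbf X^m|)\,\mathbf h_j^m/|\mathbf h_j^m|$ on $\mathbb I_j$. Bulk mesh. For each $m$, $\mathscr T^m$ is a triangulation of the fixed rectangle $\Omega$ into nondegenerate triangles with vertices $\{\mathbf a^m_k\}_{k=1}^K$, fitted to the interface: the segments $\mathbf X^m(\mathbb I_j)$ are edges of triangles of $\mathscr T^m$. $\Sigma^m$ divides $\Omega$ into $\Omega_1^m$ (below $\Sigma^m$, the droplet) and $\Omega_2^m$, and $\mathscr T_1^m$ is the sub-triangulation of $\Omega_1^m$. $\mathscr T^{m+1}$ has the same connectivity as $\mathscr T^m$, with vertices $\mathbf a_k^m$ moved to $\mathbf a_k^{m+1}$; interface vertices $\mathbf X^m(\alpha_j)$ are moved to $\mathbf X^{m+1}(\alpha_j)$, and the vertices and triangles of $\mathscr T_1^m$ correspond to those of $\mathscr T_1^{m+1}$. $\mathbb F^m$ is the space of continuous functions on $\overline{\Omega_1^m}$ that are affine on every triangle of $\mathscr T_1^m$. $(\cdot,\cdot)_{\Omega_1^m}$ is the $L^2(\Omega_1^m)$ inner product (scalar or vector). Discrete ALE mapping and mesh velocity. With $\phi_j$ the piecewise affine nodal basis function of $\mathscr T^{m+1}$ at $\mathbf a_j^{m+1}$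 and $\mathcal I_1$ the set of indices of the vertices in $\overline{\Omega_1^{m+1}}$, for $t\in[t_m,t_{m+1}]$ and $\mathbf x\in\overline{\Omega_1^{m+1}}$, $$\mathcal A_{h,t}(\mathbf x)=\sum_{j\in\mathcal I_1}\phi_j(\mathbf x)\Bigl(\tfrac{t_{m+1}-t}{\tau}\mathbf a_j^m+\tfrac{t-t_m}{\tau}\mathbf a_j^{m+1}\Bigr),\qquad \mathbf w^{m+1}(\mathbf x)=\sum_{j\in\mathcal I_1}\phi_j(\mathbf x)\,\frac{\mathbf a_j^{m+1}-\mathbf a_j^m}{\tau},$$ and $\mathbf w^{m+1}_\Sigma=\mathbf w^{m+1}|_{\Sigma^{m+1}}$. In particular $\mathcal A_{h,t_m}$ is a piecewise affine bijection of $\overline{\Omega_1^{m+1}}$ onto $\overline{\Omega_1^m}$, and $\zeta^h\circ\mathcal A_{h,t_m}^{-1}\in\mathbb F^m$ for $\zeta^h\in\mathbb F^{m+1}$. Velocity. $\mathbf u^{m+1}$ is the discrete fluid velocity, a given continuous vector field on $\overline\Omega$ that is piecewise quadratic on $\mathscr T^m$ (computed in a preceding flow step), and $\pi_2^{m+1}\mathbf u^{m+1}$ is its interpolant into continuous piecewise quadratic vector fields on $\mathscr T^{m+1}$. The meshes, $\mathbf u^{m+1}$, $\Phi^m$ and $\Gamma^m$ are data of the displayed linear system for $(\Phi^{m+1},\Gamma^{m+1})$. *)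

theory Defs
  imports "HOL-Analysis.Analysis"
begin

definition affine_map_on :: "'a::real_vector set \<Rightarrow> ('a \<Rightarrow> 'b::real_vector) \<Rightarrow> bool" where
  "affine_map_on S f \<longleftrightarrow> (\<exists>c g. linear g \<and> (\<forall>x\<in>S. f x = c + g x))"

definition quadratic_map_on :: "'a::real_vector set \<Rightarrow> ('a \<Rightarrow> 'b::real_vector) \<Rightarrow> bool" where
  "quadratic_map_on S f \<longleftrightarrow>
     (\<exists>c g B. linear g \<and> bilinear B \<and> (\<forall>x\<in>S. f x = c + g x + B x x))"

text \<open>Functions are total in HOL; membership in the following spaces only constrains the values
  on the domain \<open>D\<close> (resp. on \<open>[0,1]\<close>), values elsewhere are immaterial.\<close>

definition cont_pw_affine ::
    "'a::real_normed_vector set \<Rightarrow> 'a set set \<Rightarrow> ('a \<Rightarrow> 'b::real_normed_vector) set" where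
  "cont_pw_affine D \<T> = {f. continuous_on D f \<and> (\<forall>T\<in>\<T>. affine_map_on T f)}"

definition cont_pw_quadratic ::
    "'a::real_normed_vector set \<Rightarrow> 'a set set \<Rightarrow> ('a \<Rightarrow> 'b::real_normed_vector) set" where
  "cont_pw_quadratic D \<T> = {f. continuous_on D f \<and> (\<forall>T\<in>\<T>. quadratic_map_on T f)}"

text \<open>The data of the whole sequence of meshes. The connectivity does not depend on the time
  level: a triangle is recorded by the set of the indices of its three vertices, and only the
  positions \<open>vert M n k\<close> of the vertices change with the level \<open>n\<close>.\<close>

record moving_mesh =
  corner_lo :: "real^2"                    \<comment> \<open>\<open>\<Omega>\<close> is the open rectangle with these corners\<close>
  corner_hi :: "real^2"
  nvert :: nat                             \<comment> \<open>\<open>K\<close>; vertex indices are \<open>1..K\<close>\<close>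
  cells :: "nat set set"
  nseg :: nat                              \<comment> \<open>\<open>J\<^sub>\<Sigma>\<close>\<close>
  vert :: "nat \<Rightarrow> nat \<Rightarrow> real^2"           \<comment> \<open>level, index\<close>
  iface :: "nat \<Rightarrow> real \<Rightarrow> real^2"         \<comment> \<open>the parametrization \<open>X\<close> at each level\<close>
  dom1 :: "nat \<Rightarrow> (real^2) set"
  dom2 :: "nat \<Rightarrow> (real^2) set"

definition bulk :: "moving_mesh \<Rightarrow> (real^2) set" where
  "bulk M = box (corner_lo M) (corner_hi M)"

definition node :: "moving_mesh \<Rightarrow> nat \<Rightarrow> real" where
  "node M j = real j / real (nseg M)"

definition seg :: "moving_mesh \<Rightarrow> nat \<Rightarrow> real set" where
  "seg M j = {node M (j - 1)..node M j}"

text \<open>\<open>\<bbbK>\<^sup>h\<close> is the scalar case \<open>'b = real\<close>.\<close>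

definition iface_space :: "moving_mesh \<Rightarrow> (real \<Rightarrow> 'b::real_normed_vector) set" where
  "iface_space M = cont_pw_affine {0..1} (seg M ` {1..nseg M})"

definition hvec :: "moving_mesh \<Rightarrow> nat \<Rightarrow> nat \<Rightarrow> real^2" where
  "hvec M n j = iface M n (node M j) - iface M n (node M (j - 1))"

definition iface_curve :: "moving_mesh \<Rightarrow> nat \<Rightarrow> (real^2) set" where
  "iface_curve M n = iface M n ` {0..1}"

definition cell_hull :: "moving_mesh \<Rightarrow> nat \<Rightarrow> nat set \<Rightarrow> (real^2) set" where
  "cell_hull M n c = convex hull (vert M n ` c)"

definition tris :: "moving_mesh \<Rightarrow> nat \<Rightarrow> (real^2) set set" where
  "tris M n = cell_hull M n ` cells M"

definition tris1 :: "moving_mesh \<Rightarrow> nat \<Rightarrow> (real^2) set set" where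
  "tris1 M n = {T \<in> tris M n. T \<subseteq> closure (dom1 M n)}"

definition triangulates_bulk :: "moving_mesh \<Rightarrow> nat \<Rightarrow> bool" where
  "triangulates_bulk M n \<longleftrightarrow>
     (\<forall>c\<in>cells M. card c = 3) \<and>
     \<Union>(cells M) = {1..nvert M} \<and>
     inj_on (vert M n) {1..nvert M} \<and>
     triangulation (tris M n) \<and>
     (\<forall>T\<in>tris M n. 2 simplex T) \<and>
     \<Union>(tris M n) = closure (bulk M)"

text \<open>The curve cuts \<open>\<Omega>\<close> into exactly two connected pieces and separates them along its whole
  length. That the first piece is the one below the curve is expressed by the top side of the
  rectangle: the piece can reach that side only in points of the curve itself. (The curve need
  not be a graph, as droplets may overhang.)\<close>

definition divides_bulk :: "moving_mesh \<Rightarrow> nat \<Rightarrow> bool" where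
  "divides_bulk M n \<longleftrightarrow>
     components (bulk M - iface_curve M n) = {dom1 M n, dom2 M n} \<and>
     dom1 M n \<noteq> dom2 M n \<and>
     iface_curve M n \<subseteq> closure (dom1 M n) \<inter> closure (dom2 M n) \<and>
     closure (dom1 M n) \<inter> {x. x $ 2 = corner_hi M $ 2} \<subseteq> iface_curve M n"

definition fitted_mesh :: "moving_mesh \<Rightarrow> nat \<Rightarrow> bool" where
  "fitted_mesh M n \<longleftrightarrow>
     bulk M \<noteq> {} \<and>
     nseg M > 0 \<and>
     iface M n \<in> iface_space M \<and>
     (\<forall>j\<in>{1..nseg M}. hvec M n j \<noteq> 0) \<and>
     triangulates_bulk M n \<and>
     (\<forall>j\<in>{1..nseg M}. \<exists>T\<in>tris M n. (iface M n ` seg M j) edge_of T) \<and>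
     divides_bulk M n"

definition mesh_step :: "moving_mesh \<Rightarrow> nat \<Rightarrow> bool" where
  "mesh_step M m \<longleftrightarrow>
     (\<forall>j\<in>{0..nseg M}. \<exists>k\<in>{1..nvert M}.
        vert M m k = iface M m (node M j) \<and> vert M (Suc m) k = iface M (Suc m) (node M j)) \<and>
     (\<forall>k\<in>{1..nvert M}.
        vert M m k \<in> closure (dom1 M m) \<longleftrightarrow> vert M (Suc m) k \<in> closure (dom1 M (Suc m))) \<and>
     (\<forall>c\<in>cells M.
        cell_hull M m c \<in> tris1 M m \<longleftrightarrow> cell_hull M (Suc m) c \<in> tris1 M (Suc m))"

definition bulk_space :: "moving_mesh \<Rightarrow> nat \<Rightarrow> (real^2 \<Rightarrow> real) set" where
  "bulk_space M n = cont_pw_affine (closure (dom1 M n)) (tris1 M n)"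

definition L2_inner :: "(real^2) set \<Rightarrow> (real^2 \<Rightarrow> 'b::real_inner) \<Rightarrow> (real^2 \<Rightarrow> 'b) \<Rightarrow> real" where
  "L2_inner D f g = (LINT x:D|lebesgue. f x \<bullet> g x)"

text \<open>Unspecified where \<open>f\<close> is not differentiable; for piecewise affine \<open>f\<close> this happens only
  on the triangle sides, a null set.\<close>

definition grad :: "(real^2 \<Rightarrow> real) \<Rightarrow> real^2 \<Rightarrow> real^2" where
  "grad f x = (THE D. GDERIV f x :> D)"

definition quad_trap ::
    "moving_mesh \<Rightarrow> nat \<Rightarrow> (real \<Rightarrow> 'b::real_inner) \<Rightarrow> (real \<Rightarrow> 'b) \<Rightarrow> real" where
  "quad_trap M n u v = 1/2 * (\<Sum>j = 1..nseg M. norm (hvec M n j) *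
     (Lim (at_right (node M (j - 1))) (\<lambda>\<alpha>. u \<alpha> \<bullet> v \<alpha>) +
      Lim (at_left (node M j)) (\<lambda>\<alpha>. u \<alpha> \<bullet> v \<alpha>)))"

definition quad_simpson ::
    "moving_mesh \<Rightarrow> nat \<Rightarrow> (real \<Rightarrow> 'b::real_inner) \<Rightarrow> (real \<Rightarrow> 'b) \<Rightarrow> real" where
  "quad_simpson M n u v = 1/6 * (\<Sum>j = 1..nseg M. norm (hvec M n j) *
     (Lim (at_right (node M (j - 1))) (\<lambda>\<alpha>. u \<alpha> \<bullet> v \<alpha>) +
      4 * (u ((node M (j - 1) + node M j) / 2) \<bullet> v ((node M (j - 1) + node M j) / 2)) +
      Lim (at_left (node M j)) (\<lambda>\<alpha>. u \<alpha> \<bullet> v \<alpha>)))"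

text \<open>The index \<open>j\<close> of the segment with \<open>\<alpha>\<^sub>j\<^sub>-\<^sub>1 < \<alpha> < \<alpha>\<^sub>j\<close> is \<open>\<lceil>J\<^sub>\<Sigma> \<alpha>\<rceil>\<close>.
  The values at the nodes never enter the quadratures.\<close>

definition surf_grad :: "moving_mesh \<Rightarrow> nat \<Rightarrow> (real \<Rightarrow> real) \<Rightarrow> real \<Rightarrow> real^2" where
  "surf_grad M n \<phi> \<alpha> =
     (let j = nat \<lceil>real (nseg M) * \<alpha>\<rceil> in
        (deriv \<phi> \<alpha> / norm (vector_derivative (iface M n) (at \<alpha>))) *\<^sub>R
        (hvec M n j /\<^sub>R norm (hvec M n j)))"

text \<open>On the closure of \<open>\<Omega>\<close> the nodal basis function and the interpolant below are uniquely
  determined by the stated properties; the choice operator only selects their irrelevant values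
  outside.\<close>

definition hat :: "moving_mesh \<Rightarrow> nat \<Rightarrow> nat \<Rightarrow> real^2 \<Rightarrow> real" where
  "hat M n j = (SOME \<phi>. \<phi> \<in> cont_pw_affine (closure (bulk M)) (tris M n) \<and>
     (\<forall>k\<in>{1..nvert M}. \<phi> (vert M n k) = (if k = j then 1 else 0)))"

definition idx1 :: "moving_mesh \<Rightarrow> nat \<Rightarrow> nat set" where
  "idx1 M n = {k \<in> {1..nvert M}. vert M n k \<in> closure (dom1 M n)}"

definition ale_map :: "moving_mesh \<Rightarrow> real \<Rightarrow> nat \<Rightarrow> real \<Rightarrow> real^2 \<Rightarrow> real^2" where
  "ale_map M \<tau> m t x = (\<Sum>j\<in>idx1 M (Suc m). hat M (Suc m) j x *\<^sub>R
     (((real (Suc m) * \<tau> - t) / \<tau>) *\<^sub>R vert M m j +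
      ((t - real m * \<tau>) / \<tau>) *\<^sub>R vert M (Suc m) j))"

definition ale_inv :: "moving_mesh \<Rightarrow> real \<Rightarrow> nat \<Rightarrow> real \<Rightarrow> real^2 \<Rightarrow> real^2" where
  "ale_inv M \<tau> m t = the_inv_into (closure (dom1 M (Suc m))) (ale_map M \<tau> m t)"

text \<open>This is the velocity \<open>w\<close> at level \<open>m + 1\<close>.\<close>

definition mesh_vel :: "moving_mesh \<Rightarrow> real \<Rightarrow> nat \<Rightarrow> real^2 \<Rightarrow> real^2" where
  "mesh_vel M \<tau> m x = (\<Sum>j\<in>idx1 M (Suc m). hat M (Suc m) j x *\<^sub>R
     ((vert M (Suc m) j - vert M m j) /\<^sub>R \<tau>))"

definition vel_space :: "moving_mesh \<Rightarrow> nat \<Rightarrow> (real^2 \<Rightarrow> real^2) set" where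
  "vel_space M n = cont_pw_quadratic (closure (bulk M)) (tris M n)"

text \<open>Lagrange interpolation: the nodes are the vertices (case \<open>k = l\<close>) and the midpoints of the
  triangle sides.\<close>

definition interp2 :: "moving_mesh \<Rightarrow> nat \<Rightarrow> (real^2 \<Rightarrow> real^2) \<Rightarrow> real^2 \<Rightarrow> real^2" where
  "interp2 M n u = (SOME v. v \<in> vel_space M n \<and>
     (\<forall>c\<in>cells M. \<forall>k\<in>c. \<forall>l\<in>c.
        v (midpoint (vert M n k) (vert M n l)) = u (midpoint (vert M n k) (vert M n l))))"

end

theory Submission
  imports Defs
begin

text \<open>Testing both equations with the constant function \<open>1\<close> removes every gradient term. The
  exchange term \<open>S\<close> then appears with opposite signs in the bulk equation and in \<open>Da\<close> times the
  surface equation, so it cancels in their sum.\<close>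

text \<open>Makes the constant 1 an admissible test function in both equations, since
  \<open>bulk_space\<close> and \<open>iface_space\<close> are instances of
  \<open>cont_pw_affine\<close>. The linear part is zero.\<close>

lemma const_in_cont_pw_affine: "(\<lambda>_. c) \<in> cont_pw_affine D \<T>"
proof -
  have "affine_map_on T (\<lambda>_::'a. c)" for T
    unfolding affine_map_on_def
    by (intro exI[of _ c] exI[of _ "\<lambda>_. 0"]) (simp add: module_hom_zero)
  then show ?thesis
    by (simp add: cont_pw_affine_def)
qed

text \<open>As \<open>grad\<close> is a definite description, it must be shown that zero is the only
  gradient of a constant; this follows from uniqueness of the derivative.\<close>

lemma grad_const: "grad (\<lambda>_. c) = (\<lambda>_. 0)"
proof
  fix x :: "real^2"
  have "D = 0" if "GDERIV (\<lambda>_. c) x :> D" for D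
  proof -
    have "(\<lambda>h. h \<bullet> D) = (\<lambda>_. 0)"
      using that unfolding gderiv_def by (rule has_derivative_unique) (rule has_derivative_const)
    \<comment> \<open>Both linear maps are evaluated at \<open>h = D\<close>.\<close>
    then have "D \<bullet> D = 0"
      by (rule fun_cong)
    then show ?thesis
      by simp
  qed
  then show "grad (\<lambda>_. c) x = 0"
    unfolding grad_def by (intro the_equality GDERIV_const)
qed

text \<open>The factor \<open>deriv\<close> vanishes everywhere, so the value is zero even at the
  nodes, whatever the segment index and the denominator are there.\<close>

lemma surf_grad_const: "surf_grad M n (\<lambda>_. c) = (\<lambda>_. 0)"
  by (simp add: surf_grad_def fun_eq_iff Let_def)

lemma L2_inner_zero_right: "L2_inner D f (\<lambda>_. 0) = 0"
  by (simp add: L2_inner_def)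

text \<open>Used for the one-sided limits in the quadratures; a limit is unique only along a
  nontrivial filter, which \<open>at_left\<close> and \<open>at_right\<close> are on the
  reals.\<close>

lemma Lim_const: "F \<noteq> bot \<Longrightarrow> Lim F (\<lambda>_. c) = (c :: 'a::t2_space)"
  by (simp add: tendsto_Lim)

lemma quad_trap_zero_right: "quad_trap M n f (\<lambda>_. 0) = 0"
  by (simp add: quad_trap_def Lim_const)

lemma quad_simpson_zero_right: "quad_simpson M n f (\<lambda>_. 0) = 0"
  by (simp add: quad_simpson_def Lim_const)

theorem theorem4p1:
  fixes M :: moving_mesh and m :: nat
    and \<tau> Pe\<^sub>\<Phi> Pe\<^sub>\<Gamma> Da Bi lam :: real
    and u :: "real^2 \<Rightarrow> real^2"
    and \<Phi>\<^sub>0 \<Phi>\<^sub>1 :: "real^2 \<Rightarrow> real"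
    and \<Gamma>\<^sub>0 \<Gamma>\<^sub>1 S :: "real \<Rightarrow> real"
  assumes "\<tau> > 0" "Pe\<^sub>\<Phi> > 0" "Pe\<^sub>\<Gamma> > 0" "Da > 0" "Bi > 0" "lam > 0"
    and "fitted_mesh M m" and "fitted_mesh M (Suc m)" and "mesh_step M m"
    and "u \<in> vel_space M m"
    and "\<Phi>\<^sub>0 \<in> bulk_space M m" and "\<Gamma>\<^sub>0 \<in> iface_space M"
    and "\<Phi>\<^sub>1 \<in> bulk_space M (Suc m)" and "\<Gamma>\<^sub>1 \<in> iface_space M"
    and S: "\<And>\<alpha>. \<alpha> \<in> {0..1} \<Longrightarrow>
      S \<alpha> = Bi * lam * \<Phi>\<^sub>1 (iface M (Suc m) \<alpha>)
        - Bi * (lam * \<Phi>\<^sub>0 (ale_map M \<tau> m (real m * \<tau>) (iface M (Suc m) \<alpha>)) + 1) * \<Gamma>\<^sub>1 \<alpha>"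
    and bulk_eq: "\<And>\<zeta>. \<zeta> \<in> bulk_space M (Suc m) \<Longrightarrow>
      1/\<tau> * L2_inner (dom1 M (Suc m)) \<Phi>\<^sub>1 \<zeta>
        + 1/Pe\<^sub>\<Phi> * L2_inner (dom1 M (Suc m)) (grad \<Phi>\<^sub>1) (grad \<zeta>)
        - L2_inner (dom1 M (Suc m))
            (\<lambda>x. \<Phi>\<^sub>1 x *\<^sub>R (interp2 M (Suc m) u x - mesh_vel M \<tau> m x)) (grad \<zeta>)
      = 1/\<tau> * L2_inner (dom1 M m) \<Phi>\<^sub>0 (\<zeta> \<circ> ale_inv M \<tau> m (real m * \<tau>))
        - Da * quad_trap M (Suc m) S (\<zeta> \<circ> iface M (Suc m))"
    and surf_eq: "\<And>\<phi>. \<phi> \<in> iface_space M \<Longrightarrow>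
      1/\<tau> * quad_trap M (Suc m) \<Gamma>\<^sub>1 \<phi>
        + 1/Pe\<^sub>\<Gamma> * quad_simpson M (Suc m) (surf_grad M (Suc m) \<Gamma>\<^sub>1) (surf_grad M (Suc m) \<phi>)
        - quad_trap M (Suc m)
            (\<lambda>\<alpha>. \<Gamma>\<^sub>1 \<alpha> *\<^sub>R (interp2 M (Suc m) u (iface M (Suc m) \<alpha>)
                             - mesh_vel M \<tau> m (iface M (Suc m) \<alpha>)))
            (surf_grad M (Suc m) \<phi>)
      = 1/\<tau> * quad_trap M m \<Gamma>\<^sub>0 \<phi> + quad_trap M (Suc m) S \<phi>"
  shows "L2_inner (dom1 M (Suc m)) \<Phi>\<^sub>1 (\<lambda>_. 1) + Da * quad_trap M (Suc m) \<Gamma>\<^sub>1 (\<lambda>_. 1)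
       = L2_inner (dom1 M m) \<Phi>\<^sub>0 (\<lambda>_. 1) + Da * quad_trap M m \<Gamma>\<^sub>0 (\<lambda>_. 1)"
proof -
  \<comment> \<open>Composing the constant 1 with \<open>ale_inv\<close> or \<open>iface\<close>
    gives the constant 1 again, so the old mass and the exchange term appear untransformed.\<close>
  have bulk: "1/\<tau> * L2_inner (dom1 M (Suc m)) \<Phi>\<^sub>1 (\<lambda>_. 1)
      = 1/\<tau> * L2_inner (dom1 M m) \<Phi>\<^sub>0 (\<lambda>_. 1) - Da * quad_trap M (Suc m) S (\<lambda>_. 1)"
    using bulk_eq[of "\<lambda>_. 1"]
    by (simp add: bulk_space_def const_in_cont_pw_affine grad_const L2_inner_zero_right comp_def)
  have surf: "1/\<tau> * quad_trap M (Suc m) \<Gamma>\<^sub>1 (\<lambda>_. 1)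
      = 1/\<tau> * quad_trap M m \<Gamma>\<^sub>0 (\<lambda>_. 1) + quad_trap M (Suc m) S (\<lambda>_. 1)"
    using surf_eq[of "\<lambda>_. 1"]
    by (simp add: iface_space_def const_in_cont_pw_affine surf_grad_const
        quad_trap_zero_right quad_simpson_zero_right)
  \<comment> \<open>The factor \<open>1/\<tau>\<close> is kept so that the left-hand sides of
    \<open>bulk\<close> and \<open>surf\<close> occur literally and can be rewritten.\<close>
  have "1/\<tau> * (L2_inner (dom1 M (Suc m)) \<Phi>\<^sub>1 (\<lambda>_. 1) + Da * quad_trap M (Suc m) \<Gamma>\<^sub>1 (\<lambda>_. 1))
      = 1/\<tau> * L2_inner (dom1 M (Suc m)) \<Phi>\<^sub>1 (\<lambda>_. 1)
        + Da * (1/\<tau> * quad_trap M (Suc m) \<Gamma>\<^sub>1 (\<lambda>_. 1))"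
    by (simp add: algebra_simps)
  \<comment> \<open>The cancellation is exact because both equations apply the same quadrature on
    the same level to \<open>S\<close>.\<close>
  also have "\<dots> = 1/\<tau> * (L2_inner (dom1 M m) \<Phi>\<^sub>0 (\<lambda>_. 1) + Da * quad_trap M m \<Gamma>\<^sub>0 (\<lambda>_. 1))"
    unfolding bulk surf by (simp add: algebra_simps)
  finally show ?thesis
    using \<open>\<tau> > 0\<close> by simp
qed

end
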